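(* Let $m\ge 1$, let $\boldsymbol\theta=(\theta_1,\dots,\theta_m)\in\mathbb{R}^m$ be fixed, and let $z_1,\dots,z_m$ be independent real random variables, $z_i$ having distribution function $F_{i,\theta_i}$ and density $f_{i,\theta_i}$, where for each $i$ the family $\{F_{i,\theta}\}_{\theta\in\mathbb{R}}$ satisfies: (1) (symmetry of the null) $F_{i,0}$ is known, and $F_{i,0}(-z)=1-F_{i,0}(z)$ and $f_{i,0}(-z)=f_{i,0}(z)$ for all $z\in\mathbb{R}$; (2) (monotone likelihood ratio) for all $\theta<\theta^*$ and $z<z^*$, $\frac{f_{i,\theta^*}(z)}{f_{i,\theta}(z)}\le\frac{f_{i,\theta^*}(z^* )}{f_{i,\theta}(z^* )}$. Let $q\in(0,1)$ and let $\lambda\in(0,1)$ be a fixed (non-random) tuning parameter. Then the procedure which declares the sign of $\theta_i$ to be $\mathrm{sgn}(z_i)$ for each $i\in\mathcal{R}(t_q^\lambda)$, with $\mathcal R(\cdot)$ and $t_q^\lambda$ as defined in the context, controls the directional false discovery rate at level $q$; precisely, with $\mathcal{S}(t)=\{i\in\mathcal{R}(t):\mathrm{sgn}(\theta_i)\ne\mathrm{sgn}(z_i)\}$, $$\mathbb{E}_{\boldsymbol\theta}\left[\frac{|\mathcal{S}(t_q^\lambda)|}{|\mathcal{R}(t_q^\lambda)|\vee 1}\right]\le\Big(1-\mathbb{E}_{\boldsymbol\theta}\big[\lambda^{|\mathcal{S}(1)|}\big]\Big)q\le q .$$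
   Context: For each $i\in[m]=\{1,\dots,m\}$ and $\theta\in\mathbb{R}$, $F_{i,\theta}$ is a smooth, strictly increasing distribution function on $\mathbb{R}$ with density $f_{i,\theta}=F_{i,\theta}'>0$ with respect to Lebesgue measure. $\mathbb{E}_{\boldsymbol\theta}$ denotes expectation for the fixed parameter values $\theta_1,\dots,\theta_m$. $\mathrm{sgn}(x)=\mathbf 1(x>0)-\mathbf 1(x<0)$, and $a\vee b=\max(a,b)$. Two-sided $p$-values: $p_i=2F_{i,0}(-|z_i|)$. For $t\in[0,1]$, $\mathcal{R}(t)=\{i\in[m]:p_i\le t\}$. Null proportion estimate: $\hat\pi(\lambda)=\dfrac{|\{i:p_i>\lambda\}|+1}{(1-\lambda)m}$. FDR estimate: $\widehat{\mathrm{FDR}}_\lambda(t)=\dfrac{\hat\pi(\lambda)\,m\,t}{|\mathcal{R}(t)|\vee 1}$ if $t\le\lambda$, and $\widehat{\mathrm{FDR}}_\lambda(t)=1$ if $t>\lambda$. Threshold: $t_q^\lambda=\sup\{t\in[0,1]:\widehat{\mathrm{FDR}}_\lambda(t)\le q\}$. The directional false discovery rate of a procedure that declares signs $\widehat{sgn}_i\in\{-1,1\}$ for $i$ in a data-dependent set $\mathcal R$ is $\mathbb{E}\big[\sum_{i\in\mathcal R}\mathbf 1(\mathrm{sgn}(\theta_i)\neq\widehat{sgn}_i)/(1\vee|\mathcal R|)\big]$. *)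

theory Defs
  imports "HOL-Probability.Probability"
begin

definition distribution_function :: "(real \<Rightarrow> real) \<Rightarrow> bool" where
  "distribution_function G \<longleftrightarrow> (\<exists>D. real_distribution D \<and> G = cdf D)"

text \<open>Smooth means infinitely differentiable on the whole real line.\<close>

definition smooth :: "(real \<Rightarrow> real) \<Rightarrow> bool" where
  "smooth G \<longleftrightarrow> (\<forall>n x. (deriv ^^ n) G differentiable (at x))"

text \<open>
  The procedure takes the null distribution functions \<open>F0 i\<close> and the observed vector \<open>x\<close> as
  its only data; the family away from the null and the true parameters do not enter. The
  hypotheses have indices \<open>{1..m}\<close>; values of index functions elsewhere are irrelevant.
\<close>

definition pval :: "(nat \<Rightarrow> real \<Rightarrow> real) \<Rightarrow> (nat \<Rightarrow> real) \<Rightarrow> nat \<Rightarrow> real" where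
  "pval F0 x i = 2 * F0 i (- \<bar>x i\<bar>)"

definition rej :: "nat \<Rightarrow> (nat \<Rightarrow> real \<Rightarrow> real) \<Rightarrow> (nat \<Rightarrow> real) \<Rightarrow> real \<Rightarrow> nat set" where
  "rej m F0 x t = {i \<in> {1..m}. pval F0 x i \<le> t}"

definition pi_hat :: "nat \<Rightarrow> (nat \<Rightarrow> real \<Rightarrow> real) \<Rightarrow> (nat \<Rightarrow> real) \<Rightarrow> real \<Rightarrow> real" where
  "pi_hat m F0 x lam =
     (real (card {i \<in> {1..m}. pval F0 x i > lam}) + 1) / ((1 - lam) * real m)"

definition fdr_hat ::
    "nat \<Rightarrow> (nat \<Rightarrow> real \<Rightarrow> real) \<Rightarrow> (nat \<Rightarrow> real) \<Rightarrow> real \<Rightarrow> real \<Rightarrow> real" where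
  "fdr_hat m F0 x lam t =
     (if t \<le> lam then pi_hat m F0 x lam * real m * t / real (max (card (rej m F0 x t)) 1)
      else 1)"

text \<open>For \<open>0 \<le> q\<close> and \<open>0 \<le> lam\<close> the set below contains 0 and is bounded, so the supremum is genuine.\<close>

definition threshold ::
    "nat \<Rightarrow> (nat \<Rightarrow> real \<Rightarrow> real) \<Rightarrow> (nat \<Rightarrow> real) \<Rightarrow> real \<Rightarrow> real \<Rightarrow> real" where
  "threshold m F0 x lam q = Sup {t \<in> {0..1}. fdr_hat m F0 x lam t \<le> q}"

definition sign_errors ::
    "nat \<Rightarrow> (nat \<Rightarrow> real \<Rightarrow> real) \<Rightarrow> (nat \<Rightarrow> real) \<Rightarrow> (nat \<Rightarrow> real) \<Rightarrow> real \<Rightarrow> nat set" where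
  "sign_errors m F0 \<theta> x t = {i \<in> rej m F0 x t. sgn (\<theta> i) \<noteq> sgn (x i)}"

text \<open>
  Directional false discovery rate of the procedure that, at outcome \<open>\<omega>\<close>, declares the sign
  \<open>s \<omega> i\<close> (1 or -1) for each \<open>i\<close> in the finite set \<open>R \<omega>\<close>. With \<open>s \<omega> i = sgn (z i \<omega>)\<close> and
  \<open>R\<close> the rejections at the threshold, the value 0 does not occur on \<open>R \<omega>\<close>: the threshold is at
  most \<open>lam < 1\<close>, whereas an observation equal to 0 has p-value 1 under a symmetric null.
\<close>

definition dir_fdr ::
    "'a measure \<Rightarrow> (nat \<Rightarrow> real) \<Rightarrow> ('a \<Rightarrow> nat set) \<Rightarrow> ('a \<Rightarrow> nat \<Rightarrow> real) \<Rightarrow> real" where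
  "dir_fdr M \<theta> R s =
     (\<integral>\<omega>. (\<Sum>i\<in>R \<omega>. of_bool (sgn (\<theta> i) \<noteq> s \<omega> i)) / real (max 1 (card (R \<omega>))) \<partial>M)"

end

theory Submission
  imports Defs
begin

text \<open>
  By the monotone likelihood ratio, the p-value of a wrong-sign observation satisfies that
  \<open>P(wrong sign, p \<le> s) / s\<close> is nondecreasing in \<open>s\<close>. If hypothesis \<open>i\<close> is rejected, replacing its
  p-value by 0 does not change the threshold, so conditionally on the other observations its
  contribution to the error rate is at most \<open>(1 - lam) q e\<^sub>i / (1 + W\<^sub>i)\<close>, where
  \<open>e\<^sub>i = P(wrong sign of i)\<close> and \<open>W\<^sub>i\<close> counts the other wrong-sign hypotheses with p-value above
  \<open>lam\<close>. The expectation of \<open>1 / (1 + W\<^sub>i)\<close> is the integral over \<open>s\<close> in \<open>[0, 1]\<close> of the generating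
  function of \<open>W\<^sub>i\<close>, a product that is at most that of the factors \<open>1 - (1 - s) (1 - lam) e\<^sub>j\<close>,
  \<open>j \<noteq> i\<close>. Summed over \<open>i\<close> with weights \<open>(1 - lam) e\<^sub>i\<close> these products form the derivative in \<open>s\<close> of
  the full product, so the integral telescopes to \<open>1 - (\<Prod>j. 1 - (1 - lam) e\<^sub>j)\<close>, and the
  product is the expectation of \<open>lam\<close> to the number of wrong signs.
\<close>

section \<open>Wrong-sign p-values under a monotone likelihood ratio\<close>

text \<open>With \<open>r\<close> the likelihood ratio at \<open>a\<close>, the function
  \<open>r * H - G\<close> is nondecreasing up to \<open>a\<close> and nonincreasing afterwards. Its
  limit 0 at minus infinity gives \<open>G a \<le> r * H a\<close>, and its fall gives
  \<open>G b - G a \<ge> r * (H b - H a)\<close>.\<close>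

lemma likelihood_ratio_imp_cdf_ratio:
  fixes G H g h :: "real \<Rightarrow> real"
  assumes dG: "\<And>x. (G has_real_derivative g x) (at x)"
    and dH: "\<And>x. (H has_real_derivative h x) (at x)"
    and h: "\<And>x. h x > 0"
    and lr: "\<And>x y. x < y \<Longrightarrow> g x / h x \<le> g y / h y"
    and limG: "(G \<longlongrightarrow> 0) at_bot" and limH: "(H \<longlongrightarrow> 0) at_bot"
    and H: "H a \<ge> 0" and ab: "a \<le> b"
  shows "G a * H b \<le> G b * H a"
proof -
  define r where "r = g a / h a"
  define K where "K x = r * H x - G x" for x
  have dK: "(K has_real_derivative r * h x - g x) (at x)" for x
    unfolding K_def by (auto intro!: derivative_eq_intros dG dH)
  have below: "r * h x - g x \<ge> 0" if "x \<le> a" for x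
  proof -
    have "g x / h x \<le> r"
      using lr[of x a] that by (cases "x = a") (auto simp: r_def)
    then show ?thesis using h[of x] by (simp add: divide_le_eq)
  qed
  have above: "r * h x - g x \<le> 0" if "a \<le> x" for x
  proof -
    have "r \<le> g x / h x"
      using lr[of a x] that by (cases "x = a") (auto simp: r_def)
    then show ?thesis using h[of x] by (simp add: le_divide_eq)
  qed
  have "K x \<le> K a" if "x \<le> a" for x
    by (rule DERIV_nonneg_imp_nondecreasing[OF that]) (use dK below in blast)
  then have "eventually (\<lambda>x. K x \<le> K a) at_bot"
    by (auto simp: eventually_at_bot_linorder)
  moreover have "(K \<longlongrightarrow> r * 0 - 0) at_bot"
    unfolding K_def by (intro tendsto_intros limG limH)
  ultimately have Ka: "0 \<le> K a"
    by (intro tendsto_upperbound[of K 0 at_bot]) auto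
  have Kb: "K b \<le> K a"
    by (rule DERIV_nonpos_imp_nonincreasing[OF ab]) (use dK above in blast)
  have Hab: "H a \<le> H b"
    by (rule DERIV_nonneg_imp_nondecreasing[OF ab]) (use dH h in \<open>meson less_imp_le\<close>)
  \<comment> \<open>Both bounds compare with \<open>r\<close>; the common term
    \<open>G a * H a\<close> cancels at the end.\<close>
  have "G a * (H b - H a) \<le> (r * H a) * (H b - H a)"
    using Ka Hab by (intro mult_right_mono) (auto simp: K_def)
  also have "\<dots> = H a * (r * (H b - H a))" by simp
  also have "\<dots> \<le> H a * (G b - G a)"
    using Kb H by (intro mult_left_mono) (auto simp: K_def algebra_simps)
  finally show ?thesis by (simp add: algebra_simps)
qed

text \<open>For a negative observation, a p-value of at most \<open>u\<close> means lying at or left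
  of the cutoff \<open>c\<close> with \<open>H c = u / 2\<close>. The events are thus left tails of
  null mass \<open>s / 2\<close> and \<open>t / 2\<close>, and the two distribution functions are
  compared at these cutoffs.\<close>

lemma negative_pvalue_ratio:
  fixes H h g :: "real \<Rightarrow> real"
  assumes D: "real_distribution D"
    and dG: "\<And>x. (cdf D has_real_derivative g x) (at x)"
    and dH: "\<And>x. (H has_real_derivative h x) (at x)"
    and h: "\<And>x. h x > 0"
    and lr: "\<And>x y. x < y \<Longrightarrow> g x / h x \<le> g y / h y"
    and H: "strict_mono H" "(H \<longlongrightarrow> 0) at_bot" "H 0 = 1 / 2"
    and st: "0 < s" "s \<le> t" "t \<le> 1"
  shows "measure D {x. x < 0 \<and> 2 * H (- \<bar>x\<bar>) \<le> s} * t
    \<le> s * measure D {x. x < 0 \<and> 2 * H (- \<bar>x\<bar>) \<le> t}"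
proof -
  interpret real_distribution D by fact
  \<comment> \<open>The cutoff comes from the intermediate value theorem, as \<open>H\<close> tends
    to 0 and \<open>H 0 = 1 / 2\<close>; \<open>u \<le> 1\<close> puts it at or below 0.\<close>
  have cutoff: "\<exists>c\<le>0. H c = u / 2 \<and> measure D {x. x < 0 \<and> 2 * H (- \<bar>x\<bar>) \<le> u} = cdf D c"
    if u: "0 < u" "u \<le> 1" for u
  proof -
    have "eventually (\<lambda>x. H x < u / 2) at_bot"
      using order_tendstoD(2)[OF H(2), of "u / 2"] u by simp
    then obtain b where b: "\<And>x. x \<le> b \<Longrightarrow> H x < u / 2"
      by (auto simp: eventually_at_bot_linorder)
    have "\<exists>c. min b 0 \<le> c \<and> c \<le> 0 \<and> H c = u / 2"
      using b[of "min b 0"] u H(3) DERIV_isCont[OF dH]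
      by (intro IVT) (auto intro: less_imp_le)
    then obtain c where c: "c \<le> 0" "H c = u / 2" by blast
    \<comment> \<open>For \<open>u = 1\<close> the cutoff is 0, and \<open>{..c}\<close> contains
      the point 0 that the event excludes; continuity of the distribution function makes that point
      null.\<close>
    have null: "AE x in D. x \<noteq> 0"
      using DERIV_isCont[OF dG, of 0]
      by (subst AE_iff_measurable[of "{0}"]) (auto simp: isCont_cdf emeasure_eq_measure)
    have "measure D {x. x < 0 \<and> 2 * H (- \<bar>x\<bar>) \<le> u} = measure D {..c}"
    proof (rule finite_measure_eq_AE)
      have eq: "{x. x < 0 \<and> 2 * H (- \<bar>x\<bar>) \<le> u} = {..<0} \<inter> {..c}"
      proof -
        have "2 * H (- \<bar>x\<bar>) \<le> u \<longleftrightarrow> x \<le> c" if "x < 0" for x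
          using that c(2) strict_mono_less_eq[OF H(1), of x c] by auto
        then show ?thesis by auto
      qed
      then show "{x. x < 0 \<and> 2 * H (- \<bar>x\<bar>) \<le> u} \<in> events" by simp
      show "AE x in D. x \<in> {x. x < 0 \<and> 2 * H (- \<bar>x\<bar>) \<le> u} \<longleftrightarrow> x \<in> {..c}"
        unfolding eq using null by eventually_elim (use c in auto)
    qed simp
    then show ?thesis using c by (auto simp: cdf_def)
  qed
  obtain c where c: "H c = s / 2"
    "measure D {x. x < 0 \<and> 2 * H (- \<bar>x\<bar>) \<le> s} = cdf D c"
    using cutoff[of s] st by auto
  obtain d where d: "H d = t / 2"
    "measure D {x. x < 0 \<and> 2 * H (- \<bar>x\<bar>) \<le> t} = cdf D d"
    using cutoff[of t] st by auto
  have "c \<le> d" using c d st strict_mono_less_eq[OF H(1), of c d] by simp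
  then have "cdf D c * H d \<le> cdf D d * H c"
    using st c by (intro likelihood_ratio_imp_cdf_ratio[OF dG dH h lr cdf_lim_at_bot H(2)]) auto
  then show ?thesis using c d by (simp add: mult.commute)
qed

text \<open>Reflection turns positive observations into negative ones. The reflected density is
  \<open>g (- x)\<close>, and since \<open>h\<close> is even the nonincreasing ratio becomes
  nondecreasing.\<close>

lemma positive_pvalue_ratio:
  fixes H h g :: "real \<Rightarrow> real"
  assumes D: "real_distribution D"
    and dG: "\<And>x. (cdf D has_real_derivative g x) (at x)"
    and dH: "\<And>x. (H has_real_derivative h x) (at x)"
    and h: "\<And>x. h x > 0" "\<And>x. h (- x) = h x"
    and lr: "\<And>x y. x < y \<Longrightarrow> g y / h y \<le> g x / h x"
    and H: "strict_mono H" "(H \<longlongrightarrow> 0) at_bot" "H 0 = 1 / 2"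
    and st: "0 < s" "s \<le> t" "t \<le> 1"
  shows "measure D {x. x > 0 \<and> 2 * H (- \<bar>x\<bar>) \<le> s} * t
    \<le> s * measure D {x. x > 0 \<and> 2 * H (- \<bar>x\<bar>) \<le> t}"
proof -
  interpret real_distribution D by fact
  define D' where "D' = distr D borel uminus"
  have D': "real_distribution D'"
    unfolding D'_def by (rule real_distribution_distr) simp
  have cdf': "cdf D' = (\<lambda>y. 1 - cdf D (- y))"
  proof
    fix y
    have "cdf D' y = prob {- y..}"
      unfolding cdf_def D'_def by (subst measure_distr) (auto intro!: arg_cong[where f = prob])
    also have "\<dots> = 1 - prob {..<- y}"
      by (subst prob_compl[symmetric]) (auto intro!: arg_cong[where f = prob])
    \<comment> \<open>By continuity there is no atom at \<open>- y\<close>, so the open half-line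
      left by the complement may be closed.\<close>
    also have "prob {..<- y} = prob {..- y}"
      using DERIV_isCont[OF dG, of "- y"] unfolding isCont_cdf ivl_disj_un(2)[symmetric]
      by (subst finite_measure_Union) auto
    finally show "cdf D' y = 1 - cdf D (- y)" by (simp add: cdf_def)
  qed
  have dG': "(cdf D' has_real_derivative g (- x)) (at x)" for x
    unfolding cdf' by (auto intro!: derivative_eq_intros DERIV_chain2[OF dG])
  have meas: "{x. x < 0 \<and> 2 * H (- \<bar>x\<bar>) \<le> u} \<in> sets borel" for u
  proof -
    have [measurable]: "H \<in> borel_measurable borel"
      by (rule borel_measurable_mono[OF strict_mono_mono[OF H(1)]])
    show ?thesis by measurable
  qed
  have refl: "measure D' {x. x < 0 \<and> 2 * H (- \<bar>x\<bar>) \<le> u} =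
      measure D {x. x > 0 \<and> 2 * H (- \<bar>x\<bar>) \<le> u}" for u
    unfolding D'_def using meas
    by (subst measure_distr) (auto intro!: arg_cong[where f = prob])
  show ?thesis
    unfolding refl[symmetric]
  proof (rule negative_pvalue_ratio[OF D' dG' dH h(1) _ H st])
    show "g (- x) / h x \<le> g (- y) / h y" if "x < y" for x y
      using lr[of "- y" "- x"] that by (simp add: h(2))
  qed
qed

text \<open>Up to a null set, a wrong sign is a negative observation if \<open>\<theta> > 0\<close>,
  a positive one if \<open>\<theta> < 0\<close>, and either if \<open>\<theta> = 0\<close>. The
  ratio \<open>f \<theta> / f 0\<close> is monotone in the direction that each one-sided bound
  requires; at 0 the two bounds add.\<close>

lemma sign_error_pvalue_ratio:
  fixes F f :: "real \<Rightarrow> real \<Rightarrow> real"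
  assumes D: "real_distribution D" and cdf_D: "cdf D = F \<theta>"
    and F0: "distribution_function (F 0)" "strict_mono (F 0)"
    and deriv_F: "\<And>t x. (F t has_real_derivative f t x) (at x)"
    and pos_f: "\<And>t x. f t x > 0"
    and sym_F: "\<And>x. F 0 (- x) = 1 - F 0 x"
    and sym_f: "\<And>x. f 0 (- x) = f 0 x"
    and mlr: "\<And>t t' x x'. t < t' \<Longrightarrow> x < x' \<Longrightarrow> f t' x / f t x \<le> f t' x' / f t x'"
    and st: "0 < s" "s \<le> t" "t \<le> 1"
  shows "measure D {x. sgn \<theta> \<noteq> sgn x \<and> 2 * F 0 (- \<bar>x\<bar>) \<le> s} * t
    \<le> s * measure D {x. sgn \<theta> \<noteq> sgn x \<and> 2 * F 0 (- \<bar>x\<bar>) \<le> t}"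
proof -
  interpret real_distribution D by fact
  let ?N = "\<lambda>u. measure D {x. x < 0 \<and> 2 * F 0 (- \<bar>x\<bar>) \<le> u}"
  let ?P = "\<lambda>u. measure D {x. x > 0 \<and> 2 * F 0 (- \<bar>x\<bar>) \<le> u}"
  have [measurable]: "F 0 \<in> borel_measurable borel"
    by (rule borel_measurable_mono[OF strict_mono_mono[OF F0(2)]])
  have [measurable]: "{x. x < 0 \<and> 2 * F 0 (- \<bar>x\<bar>) \<le> u} \<in> sets borel"
    "{x. x > 0 \<and> 2 * F 0 (- \<bar>x\<bar>) \<le> u} \<in> sets borel"
    "{x. sgn \<theta> \<noteq> sgn x \<and> 2 * F 0 (- \<bar>x\<bar>) \<le> u} \<in> sets borel" for u
    by measurable
  have half: "F 0 0 = 1 / 2" using sym_F[of 0] by simp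
  have lim: "(F 0 \<longlongrightarrow> 0) at_bot"
  proof -
    obtain D0 where "real_distribution D0" and F0_eq: "F 0 = cdf D0"
      using F0(1) by (auto simp: distribution_function_def)
    then interpret D0: real_distribution D0 by simp
    show ?thesis unfolding F0_eq by (rule D0.cdf_lim_at_bot)
  qed
  have dG: "(cdf D has_real_derivative f \<theta> x) (at x)" for x
    unfolding cdf_D by (rule deriv_F)
  have null: "AE x in D. x \<noteq> 0"
    using DERIV_isCont[OF dG, of 0]
    by (subst AE_iff_measurable[of "{0}"]) (auto simp: isCont_cdf emeasure_eq_measure)
  have N: "?N s * t \<le> s * ?N t" if "\<theta> \<ge> 0"
  proof (rule negative_pvalue_ratio[OF D dG deriv_F pos_f _ F0(2) lim half st])
    show "f \<theta> x / f 0 x \<le> f \<theta> y / f 0 y" if "x < y" for x y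
    \<comment> \<open>\<open>mlr\<close> compares distinct parameters only; at
      \<open>\<theta> = 0\<close> the ratio is constantly 1.\<close>
    proof (cases "\<theta> = 0")
      case True
      then show ?thesis using pos_f[of 0 x] pos_f[of 0 y] by simp
    next
      case False
      with \<open>\<theta> \<ge> 0\<close> that show ?thesis by (intro mlr) auto
    qed
  qed
  have P: "?P s * t \<le> s * ?P t" if "\<theta> \<le> 0"
  proof (rule positive_pvalue_ratio[OF D dG deriv_F pos_f sym_f _ F0(2) lim half st])
    \<comment> \<open>For \<open>\<theta> < 0\<close> the null is the larger parameter, so
      \<open>mlr\<close> speaks of \<open>f 0 / f \<theta>\<close> and reciprocals are
      taken.\<close>
    show "f \<theta> y / f 0 y \<le> f \<theta> x / f 0 x" if "x < y" for x y
    proof (cases "\<theta> = 0")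
      case True
      then show ?thesis using pos_f[of 0 x] pos_f[of 0 y] by simp
    next
      case False
      with \<open>\<theta> \<le> 0\<close> that have "f 0 x / f \<theta> x \<le> f 0 y / f \<theta> y" by (intro mlr) auto
      then have "inverse (f 0 y / f \<theta> y) \<le> inverse (f 0 x / f \<theta> x)"
        by (rule le_imp_inverse_le) (simp add: pos_f)
      then show ?thesis by simp
    qed
  qed
  \<comment> \<open>An observation equal to 0 counts as wrong for \<open>\<theta> \<noteq> 0\<close>
    and as right for \<open>\<theta> = 0\<close>; being null, it disappears from the first two
    cases.\<close>
  have E: "measure D {x. sgn \<theta> \<noteq> sgn x \<and> 2 * F 0 (- \<bar>x\<bar>) \<le> u} =
     (if \<theta> \<ge> 0 then ?N u else 0) + (if \<theta> \<le> 0 then ?P u else 0)" for u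
  proof -
    consider "\<theta> > 0" | "\<theta> < 0" | "\<theta> = 0" by linarith
    then show ?thesis
    proof cases
      case 1
      have "AE x in D. x \<in> {x. sgn \<theta> \<noteq> sgn x \<and> 2 * F 0 (- \<bar>x\<bar>) \<le> u} \<longleftrightarrow>
          x \<in> {x. x < 0 \<and> 2 * F 0 (- \<bar>x\<bar>) \<le> u}"
        using null by eventually_elim (use 1 in \<open>auto simp: sgn_if\<close>)
      from finite_measure_eq_AE[OF this] 1 show ?thesis by simp
    next
      case 2
      have "AE x in D. x \<in> {x. sgn \<theta> \<noteq> sgn x \<and> 2 * F 0 (- \<bar>x\<bar>) \<le> u} \<longleftrightarrow>
          x \<in> {x. x > 0 \<and> 2 * F 0 (- \<bar>x\<bar>) \<le> u}"
        using null by eventually_elim (use 2 in \<open>auto simp: sgn_if\<close>)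
      from finite_measure_eq_AE[OF this] 2 show ?thesis by simp
    next
      case 3
      have split: "{x. sgn \<theta> \<noteq> sgn x \<and> 2 * F 0 (- \<bar>x\<bar>) \<le> u} =
         {x. x < 0 \<and> 2 * F 0 (- \<bar>x\<bar>) \<le> u} \<union> {x. x > 0 \<and> 2 * F 0 (- \<bar>x\<bar>) \<le> u}"
        using 3 by (auto simp: sgn_if)
      have "measure D {x. sgn \<theta> \<noteq> sgn x \<and> 2 * F 0 (- \<bar>x\<bar>) \<le> u} = ?N u + ?P u"
        unfolding split
      proof (rule finite_measure_Union)
        show "{x. x < 0 \<and> 2 * F 0 (- \<bar>x\<bar>) \<le> u} \<in> events"
          "{x. x > 0 \<and> 2 * F 0 (- \<bar>x\<bar>) \<le> u} \<in> events"
          by measurable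
      qed auto
      then show ?thesis by (simp only: 3) simp
    qed
  qed
  show ?thesis
    unfolding E distrib_left distrib_right using N P by (intro add_mono) auto
qed

section \<open>The adaptive threshold\<close>

definition rejected :: "'i set \<Rightarrow> ('i \<Rightarrow> real) \<Rightarrow> real \<Rightarrow> 'i set" where
  "rejected I p t = {i \<in> I. p i \<le> t}"

definition survivors :: "'i set \<Rightarrow> real \<Rightarrow> ('i \<Rightarrow> real) \<Rightarrow> 'i set" where
  "survivors I lam p = {i \<in> I. p i > lam}"

text \<open>The condition \<open>fdr_hat \<le> q\<close> with denominators cleared and
  \<open>t\<close> confined to \<open>{0..lam}\<close>; beyond \<open>lam\<close> the estimate is 1,
  which exceeds any \<open>q < 1\<close>.\<close>

definition admissible :: "'i set \<Rightarrow> real \<Rightarrow> real \<Rightarrow> ('i \<Rightarrow> real) \<Rightarrow> real set" where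
  "admissible I lam q p = {t \<in> {0..lam}.
     (1 + real (card (survivors I lam p))) * t \<le> (1 - lam) * q * real (max (card (rejected I p t)) 1)}"

definition storey :: "'i set \<Rightarrow> real \<Rightarrow> real \<Rightarrow> ('i \<Rightarrow> real) \<Rightarrow> real" where
  "storey I lam q p = Sup (admissible I lam q p)"

text \<open>The largest \<open>t\<close> up to \<open>lam\<close> that meets the admissibility
  inequality when the rejection count is replaced by \<open>k\<close>.\<close>

definition storey_candidate :: "'i set \<Rightarrow> real \<Rightarrow> real \<Rightarrow> ('i \<Rightarrow> real) \<Rightarrow> nat \<Rightarrow> real" where
  "storey_candidate I lam q p k =
     min lam ((1 - lam) * q * real k / (1 + real (card (survivors I lam p))))"

text \<open>Since the rejection count takes finitely many values, the supremum is attained at one of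
  finitely many explicit candidates.\<close>

lemma storey_eq_Max:
  fixes I :: "'i set"
  assumes I: "finite I" and lam: "0 < lam" "lam < 1" and q: "0 < q"
  defines "c \<equiv> storey_candidate I lam q"
  shows "storey I lam q p =
      Max ((\<lambda>k. if k \<le> max (card (rejected I p (c p k))) 1 then c p k else 0) ` {1..max (card I) 1})"
    and "storey I lam q p \<in> admissible I lam q p" and "storey I lam q p > 0"
proof -
  define N where "N = 1 + real (card (survivors I lam p))"
  have N: "N > 0" by (simp add: N_def)
  \<comment> \<open>A candidate is kept only if its own rejection count, raised to at least 1,
    reaches \<open>k\<close>; the default 0 is always admissible.\<close>
  define v where "v k = (if k \<le> max (card (rejected I p (c p k))) 1 then c p k else 0)" for k
  define K where "K = {1..max (card I) 1}"
  have K: "finite K" "K \<noteq> {}" by (auto simp: K_def)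
  have c_def': "c p k = min lam ((1 - lam) * q * real k / N)" for k
    by (simp add: c_def storey_candidate_def N_def)
  \<comment> \<open>Admissibility as self-consistency: \<open>t\<close> lies at or below the
    candidate of its own rejection count.\<close>
  have adm: "t \<in> admissible I lam q p \<longleftrightarrow>
      0 \<le> t \<and> t \<le> c p (max (card (rejected I p t)) 1)" for t
    using N by (auto simp: admissible_def c_def' le_divide_eq N_def[symmetric] mult.commute)
  have c0: "0 \<le> c p k" for k using lam q N by (auto simp: c_def')
  have cmono: "c p j \<le> c p k" if "j \<le> k" for j k
    unfolding c_def' using that lam q N
    by (intro min.mono divide_right_mono mult_left_mono) auto
  have rmono: "card (rejected I p s) \<le> card (rejected I p t)" if "s \<le> t" for s t
    using I that by (intro card_mono) (auto simp: rejected_def)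
  have v_adm: "v k \<in> admissible I lam q p" for k
    using c0 cmono by (auto simp: v_def adm)
  have le: "t \<le> Max (v ` K)" if "t \<in> admissible I lam q p" for t
  proof -
    define k where "k = max (card (rejected I p t)) 1"
    have "card (rejected I p t) \<le> card I"
      using I by (intro card_mono) (auto simp: rejected_def)
    then have k: "k \<in> K" by (auto simp: k_def K_def)
    have t: "t \<le> c p k" using that by (simp add: adm k_def)
    \<comment> \<open>As \<open>t \<le> c p k\<close>, the candidate rejects whatever
      \<open>t\<close> rejects, so it passes its own test and bounds \<open>t\<close>.\<close>
    have "k \<le> max (card (rejected I p (c p k))) 1"
      using rmono[OF t] by (auto simp: k_def)
    then have "v k = c p k" by (simp add: v_def)
    then show ?thesis using t K k by (metis Max_ge finite_imageI imageI order_trans)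
  qed
  have "Max (v ` K) \<in> v ` K" using K by (intro Max_in) auto
  then have mem: "Max (v ` K) \<in> admissible I lam q p" using v_adm by auto
  have eq: "storey I lam q p = Max (v ` K)"
    unfolding storey_def by (rule cSup_eq_maximum[OF mem le])
  show "storey I lam q p =
      Max ((\<lambda>k. if k \<le> max (card (rejected I p (c p k))) 1 then c p k else 0) ` {1..max (card I) 1})"
    using eq by (simp only: v_def[abs_def] K_def)
  show "storey I lam q p \<in> admissible I lam q p" using mem eq by simp
  \<comment> \<open>The candidate for one rejection is always kept, because the count is raised to
    at least 1.\<close>
  have "0 < c p 1" using lam q N by (auto simp: c_def')
  also have "c p 1 = v 1" by (simp add: v_def)
  also have "\<dots> \<le> Max (v ` K)" by (rule le[OF v_adm])
  finally show "storey I lam q p > 0" using eq by simp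
qed

lemma storey_le:
  assumes "finite I" "0 < lam" "lam < 1" "0 < q"
  shows "storey I lam q p \<le> lam"
  using storey_eq_Max(2)[OF assms] by (simp add: admissible_def)

lemma storey_cong:
  assumes "\<And>i. i \<in> I \<Longrightarrow> p i = p' i"
  shows "storey I lam q p = storey I lam q p'"
proof -
  have "rejected I p t = rejected I p' t" "survivors I lam p = survivors I lam p'" for t
    using assms by (auto simp: rejected_def survivors_def)
  then show ?thesis by (simp add: storey_def admissible_def)
qed

section \<open>Measurability of the threshold\<close>

lemma measurable_card_Collect:
  assumes "finite I" and [measurable]: "\<And>i. i \<in> I \<Longrightarrow> Measurable.pred M (P i)"
  shows "(\<lambda>x. real (card {i \<in> I. P i x})) \<in> borel_measurable M"
proof -
  have "real (card {i \<in> I. P i x}) = (\<Sum>i\<in>I. if P i x then 1 else 0)" for x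
    using \<open>finite I\<close> by (simp add: sum.If_cases Int_def)
  then show ?thesis by simp
qed

text \<open>The finite maximum replaces a supremum over a continuum of \<open>t\<close>. Each
  candidate is a function of the survivor count and is tested by a rejection count at a measurable
  level, so everything reduces to counts.\<close>

lemma borel_measurable_storey:
  assumes I: "finite I" and lam: "0 < lam" "lam < 1" and q: "0 < q"
    and p [measurable]: "\<And>i. i \<in> I \<Longrightarrow> (\<lambda>x. p x i) \<in> borel_measurable M"
  shows "(\<lambda>x. storey I lam q (p x)) \<in> borel_measurable M"
proof -
  have [measurable]: "(\<lambda>x. real (card (survivors I lam (p x)))) \<in> borel_measurable M"
    unfolding survivors_def by (rule measurable_card_Collect[OF I]) measurable
  have c [measurable]: "(\<lambda>x. storey_candidate I lam q (p x) k) \<in> borel_measurable M" for k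
    unfolding storey_candidate_def by measurable
  have [measurable]:
    "(\<lambda>x. real (card (rejected I (p x) (storey_candidate I lam q (p x) k)))) \<in> borel_measurable M" for k
    unfolding rejected_def by (rule measurable_card_Collect[OF I]) measurable
  \<comment> \<open>The counts are known to be measurable as reals, so the test of \<open>k\<close>
    is moved from naturals to reals.\<close>
  have eq: "k \<le> max n 1 \<longleftrightarrow> real k \<le> max (real n) 1" for k n :: nat by linarith
  show ?thesis
    unfolding storey_eq_Max(1)[OF I lam q] eq
    by (intro borel_measurable_Max) measurable
qed

text \<open>The leave-one-out step: the threshold can be read off the p-values of the other hypotheses,
  so it is independent of the p-value being rejected.\<close>

lemma storey_fun_upd_zero:
  assumes I: "finite I" and lam: "0 < lam" "lam < 1" and q: "0 < q"
    and i: "p i \<le> storey I lam q p"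
  shows "storey I lam q (p(i := 0)) = storey I lam q p"
proof -
  note params = I lam q
  define T where "T = storey I lam q p"
  define p' where "p' = p(i := 0)"
  define T' where "T' = storey I lam q p'"
  have T: "T \<in> admissible I lam q p" "T > 0" "T \<le> lam"
    and T': "T' \<in> admissible I lam q p'" "T' > 0" "T' \<le> lam"
    using storey_eq_Max(2,3)[OF params] storey_le[OF params] by (auto simp: T_def T'_def)
  have iT: "p i \<le> T" using i by (simp add: T_def)
  \<comment> \<open>Neither the old entry \<open>i\<close>, at most \<open>T \<le> lam\<close>, nor
    the new entry 0 is a survivor.\<close>
  have surv: "survivors I lam p' = survivors I lam p"
    using iT T lam by (auto simp: survivors_def p'_def)
  have rej: "rejected I p' t = rejected I p t" if "t \<ge> T" for t
    using that iT T by (auto simp: rejected_def p'_def)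
  have bdd: "bdd_above (admissible I lam q u)" for u :: "'a \<Rightarrow> real"
    by (rule bdd_aboveI[of _ lam]) (auto simp: admissible_def)
  have "T \<in> admissible I lam q p'"
    using T(1) by (simp add: admissible_def surv rej)
  then have le: "T \<le> T'"
    unfolding T'_def storey_def by (intro cSup_upper bdd)
  \<comment> \<open>The rejections are known to agree only from \<open>T\<close> upward, so
    \<open>T \<le> T'\<close> has to come first.\<close>
  have "T' \<in> admissible I lam q p"
    using T'(1) by (simp add: admissible_def surv rej[OF le])
  then have "T' \<le> T"
    unfolding T_def storey_def by (intro cSup_upper bdd)
  with le show ?thesis by (simp add: T_def T'_def p'_def)
qed

text \<open>Admissibility of the attained threshold bounds the reciprocal of the rejection count. A
  rejected \<open>i\<close> is no survivor and its p-value may be set to 0, so the right-hand side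
  involves only the other p-values.\<close>

lemma inverse_rejections_le:
  assumes I: "finite I" and lam: "0 < lam" "lam < 1" and q: "0 < q"
    and i: "i \<in> I" "p i \<le> storey I lam q p"
  shows "1 / real (max (card (rejected I p (storey I lam q p))) 1) \<le>
    (1 - lam) * q * (1 / (storey I lam q (p(i := 0)) * (1 + real (card (survivors (I - {i}) lam p)))))"
proof -
  define T where "T = storey I lam q p"
  have T: "T \<in> admissible I lam q p" "T > 0" "T \<le> lam"
    using storey_eq_Max(2,3)[OF I lam q] storey_le[OF I lam q] by (auto simp: T_def)
  have surv: "survivors (I - {i}) lam p = survivors I lam p"
    using i T by (auto simp: survivors_def T_def)
  define R where "R = real (max (card (rejected I p T)) 1)"
  define N where "N = 1 + real (card (survivors I lam p))"
  have pos: "R > 0" "N > 0" by (auto simp: R_def N_def)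
  have "N * T \<le> (1 - lam) * q * R"
    using T(1) by (simp add: admissible_def R_def N_def)
  then have "1 / R \<le> (1 - lam) * q * (1 / (T * N))"
    using pos T by (simp add: field_simps)
  then show ?thesis
    by (simp add: storey_fun_upd_zero[OF I lam q i(2)] surv R_def N_def T_def)
qed

text \<open>The factor \<open>m\<close> cancels against the one in the null-proportion estimate. The
  value 1 beyond \<open>lam\<close> exceeds \<open>q\<close>, so both suprema range over the same
  subset of \<open>{0..lam}\<close>.\<close>

lemma threshold_eq_storey:
  assumes m: "m \<ge> 1" and lam: "0 < lam" "lam < 1" and q: "0 < q" "q < 1"
  shows "threshold m F0 x lam q = storey {1..m} lam q (pval F0 x)"
proof -
  have "fdr_hat m F0 x lam t \<le> q \<longleftrightarrow> t \<le> lam \<and>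
      (1 + real (card (survivors {1..m} lam (pval F0 x)))) * t
        \<le> (1 - lam) * q * real (max (card (rejected {1..m} (pval F0 x) t)) 1)" for t
  proof -
    define R where "R = real (max (card (rejected {1..m} (pval F0 x) t)) 1)"
    have "R > 0" by (simp add: R_def)
    define N where "N = real (card (survivors {1..m} lam (pval F0 x)))"
    have pi: "(N + 1) / ((1 - lam) * real m) * real m = (N + 1) / (1 - lam)"
      using m by simp
    show ?thesis
      unfolding fdr_hat_def pi_hat_def rej_def rejected_def[symmetric] survivors_def[symmetric]
        R_def[symmetric] N_def[symmetric] pi
      using \<open>R > 0\<close> lam q by (auto simp: field_simps)
  qed
  then show ?thesis
    unfolding threshold_def storey_def admissible_def using lam
    by (intro arg_cong[where f = Sup]) auto
qed

section \<open>Counts of independent events\<close>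

lemma nn_integral_power_unit_interval:
  "(\<integral>\<^sup>+s. ennreal (s ^ k) * indicator {0..1} s \<partial>lborel) = ennreal (1 / (1 + real k))"
proof -
  have "(\<integral>\<^sup>+s. ennreal (s ^ k) * indicator {0..1} s \<partial>lborel) =
      1 ^ Suc k / real (Suc k) - 0 ^ Suc k / real (Suc k)"
  proof (rule nn_integral_FTC_Icc)
    show "((\<lambda>s. s ^ Suc k / real (Suc k)) has_real_derivative s ^ k) (at s)" for s
      using DERIV_cdivide[OF DERIV_pow[of "Suc k" s], of "real (Suc k)"]
      by (simp del: of_nat_Suc power_Suc)
  qed auto
  then show ?thesis by simp
qed

text \<open>The weighted integrands add up to the derivative of the product of the factors
  \<open>1 - (1 - s) * c j\<close>.\<close>

lemma nn_integral_sum_leave_one_out_prod: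
  fixes c :: "'i \<Rightarrow> real"
  assumes c: "\<And>i. i \<in> I \<Longrightarrow> 0 \<le> c i" "\<And>i. i \<in> I \<Longrightarrow> c i \<le> 1"
  shows "(\<Sum>i\<in>I. ennreal (c i) *
      (\<integral>\<^sup>+s. ennreal (\<Prod>j\<in>I - {i}. 1 - (1 - s) * c j) * indicator {0..1} s \<partial>lborel)) =
    ennreal (1 - (\<Prod>i\<in>I. 1 - c i))"
proof -
  have factor: "0 \<le> 1 - (1 - s) * c i" if "i \<in> I" "0 \<le> s" "s \<le> 1" for i s
    using c[OF that(1)] that mult_le_one[of "1 - s" "c i"] by auto
  have "(\<Sum>i\<in>I. ennreal (c i) *
      (\<integral>\<^sup>+s. ennreal (\<Prod>j\<in>I - {i}. 1 - (1 - s) * c j) * indicator {0..1} s \<partial>lborel)) =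
    (\<integral>\<^sup>+s. (\<Sum>i\<in>I. ennreal (c i) *
      (ennreal (\<Prod>j\<in>I - {i}. 1 - (1 - s) * c j) * indicator {0..1} s)) \<partial>lborel)"
    by (subst nn_integral_sum) (auto simp: nn_integral_cmult)
  also have "\<dots> = (\<integral>\<^sup>+s. ennreal (\<Sum>i\<in>I. c i * (\<Prod>j\<in>I - {i}. 1 - (1 - s) * c j))
      * indicator {0..1} s \<partial>lborel)"
  proof (rule nn_integral_cong)
    fix s :: real
    show "(\<Sum>i\<in>I. ennreal (c i) *
        (ennreal (\<Prod>j\<in>I - {i}. 1 - (1 - s) * c j) * indicator {0..1} s)) =
      ennreal (\<Sum>i\<in>I. c i * (\<Prod>j\<in>I - {i}. 1 - (1 - s) * c j)) * indicator {0..1} s"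
    proof (cases "s \<in> {0..1}")
      case True
      have "0 \<le> (\<Prod>j\<in>I - {i}. 1 - (1 - s) * c j)" for i
        using True factor by (intro prod_nonneg) auto
      with True c show ?thesis
        by (simp add: ennreal_mult'' sum_ennreal[symmetric] del: sum_ennreal)
    qed simp
  qed
  also have "\<dots> = (\<Prod>i\<in>I. 1 - (1 - 1) * c i) - (\<Prod>i\<in>I. 1 - (1 - 0) * c i)"
  proof (rule nn_integral_FTC_Icc)
    show "((\<lambda>s. \<Prod>i\<in>I. 1 - (1 - s) * c i) has_real_derivative
        (\<Sum>i\<in>I. c i * (\<Prod>j\<in>I - {i}. 1 - (1 - s) * c j))) (at s)" for s
      by (rule has_field_derivative_prod)
         (auto intro!: derivative_eq_intros)
    show "0 \<le> (\<Sum>i\<in>I. c i * (\<Prod>j\<in>I - {i}. 1 - (1 - s) * c j))" if "s \<in> {0..1}" for s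
      using that factor c by (intro sum_nonneg mult_nonneg_nonneg prod_nonneg) auto
  qed auto
  finally show ?thesis by simp
qed

context prob_space
begin

text \<open>The generating function of a sum of independent indicators: the power is a product of
  independent factors, equal to \<open>s\<close> on \<open>B i\<close> and 1 off it. It serves for
  all \<open>s\<close> under an integral and once more at \<open>s = lam\<close>.\<close>

lemma nn_integral_power_card_indep:
  fixes z :: "'i \<Rightarrow> 'a \<Rightarrow> real"
  assumes I: "finite I" and indep: "indep_vars (\<lambda>_. borel) z I"
    and B: "\<And>i. i \<in> I \<Longrightarrow> B i \<in> sets borel" and s: "0 \<le> s" "s \<le> 1"
  shows "(\<integral>\<^sup>+\<omega>. ennreal (s ^ card {i \<in> I. z i \<omega> \<in> B i}) \<partial>M) =
    ennreal (\<Prod>i\<in>I. 1 - (1 - s) * measure (distr M borel (z i)) (B i))"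
proof -
  define \<phi> where "\<phi> i x = (if x \<in> B i then s else 1)" for i x
  have [measurable]: "\<phi> i \<in> borel_measurable borel" if "i \<in> I" for i
    using B[OF that] unfolding \<phi>_def by measurable
  have \<phi>0: "0 \<le> \<phi> i x" for i x using s by (simp add: \<phi>_def)
  have z: "random_variable borel (z i)" if "i \<in> I" for i
    using indep that by (auto simp: indep_vars_def)
  have "s ^ card {i \<in> I. z i \<omega> \<in> B i} = (\<Prod>i\<in>I. \<phi> i (z i \<omega>))" for \<omega>
    using I by (simp add: \<phi>_def prod.If_cases Int_def)
  then have "(\<integral>\<^sup>+\<omega>. ennreal (s ^ card {i \<in> I. z i \<omega> \<in> B i}) \<partial>M) =
      (\<integral>\<^sup>+\<omega>. (\<Prod>i\<in>I. ennreal (\<phi> i (z i \<omega>))) \<partial>M)"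
    using \<phi>0 by (simp add: prod_ennreal)
  also have "\<dots> = (\<Prod>i\<in>I. \<integral>\<^sup>+\<omega>. ennreal (\<phi> i (z i \<omega>)) \<partial>M)"
    using I by (intro indep_vars_nn_integral indep_vars_compose2[OF indep]) auto
  also have "\<dots> = (\<Prod>i\<in>I. ennreal (1 - (1 - s) * measure (distr M borel (z i)) (B i)))"
  proof (rule prod.cong[OF refl])
    fix i assume i: "i \<in> I"
    note [measurable] = z[OF i] B[OF i]
    interpret Z: prob_space "distr M borel (z i)" by (rule prob_space_distr) measurable
    have [measurable]: "\<phi> i \<in> borel_measurable borel" using i by measurable
    have "(\<integral>\<^sup>+\<omega>. ennreal (\<phi> i (z i \<omega>)) \<partial>M) = (\<integral>\<^sup>+x. ennreal (\<phi> i x) \<partial>distr M borel (z i))"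
      by (subst nn_integral_distr) auto
    also have "\<dots> = ennreal (\<integral>x. \<phi> i x \<partial>distr M borel (z i))"
      using s by (intro nn_integral_eq_integral Z.integrable_const_bound[of _ 1])
        (auto simp: \<phi>_def)
    also have "(\<integral>x. \<phi> i x \<partial>distr M borel (z i)) =
        (\<integral>x. 1 - (1 - s) * indicator (B i) x \<partial>distr M borel (z i))"
      by (intro Bochner_Integration.integral_cong) (auto simp: \<phi>_def)
    also have "\<dots> = 1 - (1 - s) * Z.prob (B i)"
      using Z.prob_space
      by (subst Bochner_Integration.integral_diff) (auto simp: Z.emeasure_eq_measure)
    finally show "(\<integral>\<^sup>+\<omega>. ennreal (\<phi> i (z i \<omega>)) \<partial>M) = ennreal (1 - (1 - s) * Z.prob (B i))" .
  qed
  also have "\<dots> = ennreal (\<Prod>i\<in>I. 1 - (1 - s) * measure (distr M borel (z i)) (B i))"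
  proof (rule prod_ennreal)
    fix i assume i: "i \<in> I"
    interpret Z: prob_space "distr M borel (z i)" by (rule prob_space_distr[OF z[OF i]])
    show "0 \<le> 1 - (1 - s) * Z.prob (B i)"
      using s mult_le_one[of "1 - s" "Z.prob (B i)"] by auto
  qed
  finally show ?thesis .
qed

text \<open>Uses \<open>1 / (1 + k) = \<integral> s ^ k\<close> over the unit interval.\<close>

lemma nn_integral_inverse_Suc_card_indep:
  fixes z :: "'i \<Rightarrow> 'a \<Rightarrow> real"
  assumes I: "finite I" and indep: "indep_vars (\<lambda>_. borel) z I"
    and B: "\<And>i. i \<in> I \<Longrightarrow> B i \<in> sets borel"
  shows "(\<integral>\<^sup>+\<omega>. ennreal (1 / (1 + real (card {i \<in> I. z i \<omega> \<in> B i}))) \<partial>M) =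
    (\<integral>\<^sup>+s. ennreal (\<Prod>i\<in>I. 1 - (1 - s) * measure (distr M borel (z i)) (B i))
      * indicator {0..1} s \<partial>lborel)"
proof -
  define k where "k \<omega> = card {i \<in> I. z i \<omega> \<in> B i}" for \<omega>
  have z [measurable]: "random_variable borel (z i)" if "i \<in> I" for i
    using indep that by (auto simp: indep_vars_def)
  \<comment> \<open>Written as a product, the power with random exponent is visibly jointly
    measurable in \<open>s\<close> and \<open>\<omega>\<close>, as exchanging the integrals
    requires.\<close>
  have "s ^ k \<omega> = (\<Prod>i\<in>I. if z i \<omega> \<in> B i then s else 1)" for \<omega> and s :: real
    using I by (simp add: k_def prod.If_cases Int_def)
  moreover have "(\<lambda>x. \<Prod>i\<in>I. if z i (snd x) \<in> B i then fst x else 1 :: real)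
      \<in> borel_measurable (lborel \<Otimes>\<^sub>M M)"
    using B by measurable
  ultimately have meas: "(\<lambda>(s, \<omega>). ennreal (s ^ k \<omega>) * indicator {0..1} s)
      \<in> borel_measurable (lborel \<Otimes>\<^sub>M M)"
    by (auto simp: case_prod_beta')
  interpret P: pair_sigma_finite lborel M ..
  have "(\<integral>\<^sup>+\<omega>. ennreal (1 / (1 + real (k \<omega>))) \<partial>M) =
      (\<integral>\<^sup>+\<omega>. (\<integral>\<^sup>+s. ennreal (s ^ k \<omega>) * indicator {0..1} s \<partial>lborel) \<partial>M)"
    by (simp only: nn_integral_power_unit_interval)
  also have "\<dots> = (\<integral>\<^sup>+s. (\<integral>\<^sup>+\<omega>. ennreal (s ^ k \<omega>) * indicator {0..1} s \<partial>M) \<partial>lborel)"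
    by (rule P.Fubini'[OF meas])
  also have "\<dots> = (\<integral>\<^sup>+s. ennreal (\<Prod>i\<in>I. 1 - (1 - s) * measure (distr M borel (z i)) (B i))
      * indicator {0..1} s \<partial>lborel)"
  proof (rule nn_integral_cong)
    fix s :: real
    show "(\<integral>\<^sup>+\<omega>. ennreal (s ^ k \<omega>) * indicator {0..1} s \<partial>M) =
      ennreal (\<Prod>i\<in>I. 1 - (1 - s) * measure (distr M borel (z i)) (B i)) * indicator {0..1} s"
      using nn_integral_power_card_indep[OF I indep B, where s = s]
      by (cases "s \<in> {0..1}") (auto simp: k_def)
  qed
  finally show ?thesis by (simp add: k_def)
qed

text \<open>Independence makes the joint law of \<open>z i\<close> and the remaining family a
  product, so \<open>z i\<close> can be integrated out first with the others frozen at
  \<open>y\<close>.\<close>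

lemma nn_integral_leave_one_out_le:
  assumes indep: "indep_vars N z I" and i: "i \<in> I"
    and h [measurable]: "(\<lambda>(x, y). h x y) \<in> borel_measurable (N i \<Otimes>\<^sub>M PiM (I - {i}) N)"
    and k [measurable]: "k \<in> borel_measurable (PiM (I - {i}) N)"
    and le: "\<And>y. y \<in> space (PiM (I - {i}) N) \<Longrightarrow> (\<integral>\<^sup>+x. h x y \<partial>distr M (N i) (z i)) \<le> k y"
  shows "(\<integral>\<^sup>+\<omega>. h (z i \<omega>) (\<lambda>j\<in>I - {i}. z j \<omega>) \<partial>M) \<le> (\<integral>\<^sup>+\<omega>. k (\<lambda>j\<in>I - {i}. z j \<omega>) \<partial>M)"
proof -
  define S where "S = PiM {i} N"
  define T where "T = PiM (I - {i}) N"
  \<comment> \<open>\<open>z i\<close> is wrapped as a family over \<open>{i}\<close>, the form in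
    which independence of disjoint groups of variables is available.\<close>
  define X where "X \<omega> = (\<lambda>j\<in>{i}. z j \<omega>)" for \<omega>
  define Y where "Y \<omega> = (\<lambda>j\<in>I - {i}. z j \<omega>)" for \<omega>
  have XY: "indep_var S X T Y"
    unfolding S_def X_def[abs_def] T_def Y_def[abs_def]
    using i by (intro indep_var_restrict[OF indep]) auto
  have X [measurable]: "random_variable S X" and Y [measurable]: "random_variable T Y"
    using XY by (auto dest: indep_var_rv1 indep_var_rv2)
  have X_i: "X \<omega> i = z i \<omega>" for \<omega> by (simp add: X_def)
  have z [measurable]: "random_variable (N i) (z i)"
    using indep i by (auto simp: indep_vars_def)
  have comp [measurable]: "(\<lambda>x. x i) \<in> measurable S (N i)"
    unfolding S_def by (rule measurable_component_singleton) simp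
  note [measurable] = h[folded T_def] k[folded T_def]
  interpret X: prob_space "distr M S X" by (rule prob_space_distr[OF X])
  interpret Y: prob_space "distr M T Y" by (rule prob_space_distr[OF Y])
  interpret P: pair_sigma_finite "distr M S X" "distr M T Y" ..
  have "(\<integral>\<^sup>+\<omega>. h (z i \<omega>) (Y \<omega>) \<partial>M) =
      (\<integral>\<^sup>+p. (case p of (x, y) \<Rightarrow> h (x i) y) \<partial>distr M (S \<Otimes>\<^sub>M T) (\<lambda>\<omega>. (X \<omega>, Y \<omega>)))"
    by (subst nn_integral_distr) (auto simp: X_i)
  also have "\<dots> = (\<integral>\<^sup>+p. (case p of (x, y) \<Rightarrow> h (x i) y) \<partial>(distr M S X \<Otimes>\<^sub>M distr M T Y))"
    using XY by (simp add: indep_var_distribution_eq)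
  also have "\<dots> = (\<integral>\<^sup>+y. (\<integral>\<^sup>+x. h (x i) y \<partial>distr M S X) \<partial>distr M T Y)"
    by (subst P.nn_integral_snd[symmetric]) auto
  also have "\<dots> \<le> (\<integral>\<^sup>+y. k y \<partial>distr M T Y)"
  proof (rule nn_integral_mono)
    fix y assume "y \<in> space (distr M T Y)"
    then have y: "y \<in> space T" by simp
    have "(\<integral>\<^sup>+x. h (x i) y \<partial>distr M S X) = (\<integral>\<^sup>+\<omega>. h (z i \<omega>) y \<partial>M)"
      using y by (subst nn_integral_distr) (auto simp: X_i)
    also have "\<dots> = (\<integral>\<^sup>+x. h x y \<partial>distr M (N i) (z i))"
      using y by (subst nn_integral_distr) auto
    finally show "(\<integral>\<^sup>+x. h (x i) y \<partial>distr M S X) \<le> k y"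
      using le y by (simp add: T_def)
  qed
  also have "\<dots> = (\<integral>\<^sup>+\<omega>. k (Y \<omega>) \<partial>M)"
    by (subst nn_integral_distr) auto
  finally show ?thesis by (simp add: Y_def)
qed

subsection \<open>The error rate of the adaptive procedure\<close>

context
  fixes z :: "'i \<Rightarrow> 'a \<Rightarrow> real" and I :: "'i set" and pv :: "'i \<Rightarrow> real \<Rightarrow> real"
    and E :: "'i \<Rightarrow> real set" and lam q :: real
  assumes I: "finite I" and indep: "indep_vars (\<lambda>_. borel) z I"
    and pv: "\<And>i. i \<in> I \<Longrightarrow> pv i \<in> borel_measurable borel"
    and E: "\<And>i. i \<in> I \<Longrightarrow> E i \<in> sets borel"
    and pv_le: "\<And>i x. i \<in> I \<Longrightarrow> pv i x \<le> 1"
    and ratio: "\<And>i s t. i \<in> I \<Longrightarrow> 0 < s \<Longrightarrow> s \<le> t \<Longrightarrow> t \<le> 1 \<Longrightarrow>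
      measure (distr M borel (z i)) {x \<in> E i. pv i x \<le> s} * t \<le>
      s * measure (distr M borel (z i)) {x \<in> E i. pv i x \<le> t}"
    and lam: "0 < lam" "lam < 1" and q: "0 < q"
begin

text \<open>The comparison in \<open>ratio\<close> with \<open>t = 1\<close>, a level that every
  p-value meets.\<close>

lemma early_error_bound:
  assumes i: "i \<in> I" and s: "0 < s" "s \<le> lam"
  shows "measure (distr M borel (z i)) {x \<in> E i. pv i x \<le> s}
    \<le> s * measure (distr M borel (z i)) (E i)"
  using ratio[OF i s(1), of 1] s lam pv_le[OF i] by simp

text \<open>At most the share \<open>lam\<close> of the wrong-sign probability sits at p-values up
  to \<open>lam\<close>, so at least the share \<open>1 - lam\<close> sits above.\<close>

lemma late_error_bound:
  assumes i: "i \<in> I"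
  shows "(1 - lam) * measure (distr M borel (z i)) (E i)
    \<le> measure (distr M borel (z i)) {x \<in> E i. lam < pv i x}"
proof -
  have z: "random_variable borel (z i)" using indep i by (auto simp: indep_vars_def)
  interpret Z: prob_space "distr M borel (z i)" by (rule prob_space_distr[OF z])
  note [measurable] = pv[OF i] E[OF i]
  have "E i = {x \<in> E i. pv i x \<le> lam} \<union> {x \<in> E i. lam < pv i x}" by auto
  then have "Z.prob (E i) = Z.prob {x \<in> E i. pv i x \<le> lam} + Z.prob {x \<in> E i. lam < pv i x}"
    by (subst Z.finite_measure_Union[symmetric]) auto
  then show ?thesis
    using early_error_bound[OF i lam(1) order.refl] by (simp add: algebra_simps)
qed

text \<open>With the other observations fixed, the threshold is a constant in
  \<open>{0<..lam}\<close>, and a wrong sign with p-value up to it has probability at most the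
  threshold times that of \<open>E i\<close>. This factor cancels the threshold in the
  denominator.\<close>

lemma rejected_error_term:
  assumes i: "i \<in> I"
  defines "N \<equiv> \<lambda>\<omega>. real (card (survivors (I - {i}) lam (\<lambda>j. pv j (z j \<omega>))))"
    and "T \<equiv> \<lambda>\<omega>. storey I lam q ((\<lambda>j. pv j (z j \<omega>))(i := 0))"
  shows "(\<integral>\<^sup>+\<omega>. ennreal (if z i \<omega> \<in> E i \<and> pv i (z i \<omega>) \<le> T \<omega> then 1 / (T \<omega> * (1 + N \<omega>)) else 0) \<partial>M)
    \<le> ennreal (measure (distr M borel (z i)) (E i)) * (\<integral>\<^sup>+\<omega>. ennreal (1 / (1 + N \<omega>)) \<partial>M)"
proof -
  let ?P = "\<lambda>y. (\<lambda>j. pv j (y j))(i := 0)"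
  define N' where "N' y = real (card (survivors (I - {i}) lam (\<lambda>j. pv j (y j))))" for y
  define T' where "T' y = storey I lam q (?P y)" for y
  define e where "e = measure (distr M borel (z i)) (E i)"
  let ?L = "PiM (I - {i}) (\<lambda>_. borel :: real measure)"
  have z: "random_variable borel (z i)" using indep i by (auto simp: indep_vars_def)
  interpret Z: prob_space "distr M borel (z i)" by (rule prob_space_distr[OF z])
  note [measurable] = pv[OF i] E[OF i]
  have coord: "(\<lambda>y. pv j (y j)) \<in> borel_measurable ?L" if "j \<in> I - {i}" for j
  proof -
    note [measurable] = pv[of j]
    have [measurable]: "(\<lambda>y. y j) \<in> borel_measurable ?L"
      by (rule measurable_component_singleton[OF that])
    show ?thesis using that by simp
  qed
  have "(\<lambda>y. ?P y j) \<in> borel_measurable ?L" if "j \<in> I" for j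
    using coord[of j] that by (cases "j = i") auto
  then have [measurable]: "T' \<in> borel_measurable ?L"
    unfolding T'_def by (intro borel_measurable_storey I lam q)
  have [measurable]: "N' \<in> borel_measurable ?L"
    unfolding N'_def survivors_def using I coord
    by (intro measurable_card_Collect) (auto intro!: borel_measurable_less)
  \<comment> \<open>The restricted family is undefined at \<open>i\<close>, but \<open>T'\<close>
    overwrites that entry and \<open>N'\<close> skips it.\<close>
  have restr: "T' (\<lambda>j\<in>I - {i}. z j \<omega>) = T \<omega>" "N' (\<lambda>j\<in>I - {i}. z j \<omega>) = N \<omega>" for \<omega>
    unfolding T'_def T_def N'_def N_def
    by (auto intro!: storey_cong arg_cong[where f = card] simp: survivors_def)
  have N'0: "0 \<le> N' y" for y by (simp add: N'_def)
  have "(\<integral>\<^sup>+\<omega>. ennreal (if z i \<omega> \<in> E i \<and> pv i (z i \<omega>) \<le> T' (\<lambda>j\<in>I - {i}. z j \<omega>)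
        then 1 / (T' (\<lambda>j\<in>I - {i}. z j \<omega>) * (1 + N' (\<lambda>j\<in>I - {i}. z j \<omega>))) else 0) \<partial>M)
    \<le> (\<integral>\<^sup>+\<omega>. ennreal (e * (1 / (1 + N' (\<lambda>j\<in>I - {i}. z j \<omega>)))) \<partial>M)"
  proof (rule nn_integral_leave_one_out_le[OF indep i])
    fix y :: "'i \<Rightarrow> real"
    have T'y: "0 < T' y" "T' y \<le> lam"
      unfolding T'_def using storey_eq_Max(3)[OF I lam q] storey_le[OF I lam q] by auto
    have "(\<integral>\<^sup>+x. ennreal (if x \<in> E i \<and> pv i x \<le> T' y then 1 / (T' y * (1 + N' y)) else 0)
        \<partial>distr M borel (z i)) =
      (\<integral>\<^sup>+x. ennreal (1 / (T' y * (1 + N' y))) * indicator {x \<in> E i. pv i x \<le> T' y} x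
        \<partial>distr M borel (z i))"
      by (intro nn_integral_cong) auto
    also have "\<dots> = ennreal (1 / (T' y * (1 + N' y)) * Z.prob {x \<in> E i. pv i x \<le> T' y})"
      using T'y N'0[of y] by (subst nn_integral_cmult_indicator)
        (auto simp only: Z.emeasure_eq_measure intro!: ennreal_mult[symmetric], auto)
    also have "\<dots> \<le> ennreal (1 / (T' y * (1 + N' y)) * (T' y * e))"
      using T'y N'0[of y] early_error_bound[OF i T'y]
      by (intro ennreal_leI mult_left_mono) (auto simp: e_def)
    also have "\<dots> = ennreal (e * (1 / (1 + N' y)))" using T'y by simp
    finally show "(\<integral>\<^sup>+x. ennreal (if x \<in> E i \<and> pv i x \<le> T' y then 1 / (T' y * (1 + N' y)) else 0)
        \<partial>distr M borel (z i)) \<le> ennreal (e * (1 / (1 + N' y)))" .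
  qed measurable
  also have "\<dots> = (\<integral>\<^sup>+\<omega>. ennreal e * ennreal (1 / (1 + N \<omega>)) \<partial>M)"
    unfolding restr by (intro nn_integral_cong ennreal_mult) (auto simp: e_def N_def)
  also have "\<dots> = ennreal e * (\<integral>\<^sup>+\<omega>. ennreal (1 / (1 + N \<omega>)) \<partial>M)"
  proof (rule nn_integral_cmult)
    have "random_variable borel (\<lambda>\<omega>. pv j (z j \<omega>))" if "j \<in> I" for j
      using that indep pv by (auto simp: indep_vars_def)
    then have [measurable]: "N \<in> borel_measurable M"
      unfolding N_def survivors_def using I
      by (intro measurable_card_Collect) (auto intro!: borel_measurable_less)
    show "(\<lambda>\<omega>. ennreal (1 / (1 + N \<omega>))) \<in> borel_measurable M" by measurable
  qed
  finally show ?thesis unfolding restr e_def .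
qed

text \<open>\<open>E i\<close> stands for the wrong-sign observations, linked to the p-values
  through \<open>ratio\<close>; no parametric family appears at this level.\<close>

theorem storey_error_rate:
  defines "P \<equiv> \<lambda>\<omega> i. pv i (z i \<omega>)"
  defines "T \<equiv> \<lambda>\<omega>. storey I lam q (P \<omega>)"
  shows "(\<integral>\<omega>. real (card {i \<in> rejected I (P \<omega>) (T \<omega>). z i \<omega> \<in> E i})
        / real (max (card (rejected I (P \<omega>) (T \<omega>))) 1) \<partial>M)
    \<le> (1 - (\<integral>\<omega>. lam ^ card {i \<in> I. z i \<omega> \<in> E i} \<partial>M)) * q"
proof -
  define e where "e i = measure (distr M borel (z i)) (E i)" for i
  define b where "b i = measure (distr M borel (z i)) {x \<in> E i. lam < pv i x}" for i
  \<comment> \<open>\<open>c i\<close> is both a lower bound for \<open>b i\<close>, the probability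
    of a wrong sign that survives, and the weight of term \<open>i\<close> in the telescoping
    sum.\<close>
  define c where "c i = (1 - lam) * e i" for i
  define N where "N i \<omega> = real (card (survivors (I - {i}) lam (P \<omega>)))" for i \<omega>
  define T' where "T' i \<omega> = storey I lam q ((P \<omega>)(i := 0))" for i \<omega>
  define R where "R \<omega> = real (max (card (rejected I (P \<omega>) (T \<omega>))) 1)" for \<omega>
  define h where "h i \<omega> =
    (if z i \<omega> \<in> E i \<and> P \<omega> i \<le> T' i \<omega> then 1 / (T' i \<omega> * (1 + N i \<omega>)) else 0)" for i \<omega>
  have z: "random_variable borel (z i)" if "i \<in> I" for i
    using indep that by (auto simp: indep_vars_def)
  have prob01: "0 \<le> measure (distr M borel (z i)) A \<and> measure (distr M borel (z i)) A \<le> 1"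
    if "i \<in> I" for i A
  proof -
    interpret Z: prob_space "distr M borel (z i)" by (rule prob_space_distr[OF z[OF that]])
    show ?thesis by simp
  qed
  have c01: "0 \<le> c i" "c i \<le> 1" "c i \<le> b i" "0 \<le> e i" if "i \<in> I" for i
    using prob01[OF that] lam late_error_bound[OF that]
    by (auto simp: c_def e_def b_def intro: mult_le_one)
  have P_meas [measurable]: "(\<lambda>\<omega>. P \<omega> i) \<in> borel_measurable M" if "i \<in> I" for i
    using measurable_compose[OF z pv] that by (simp add: P_def)
  have T'_pos: "0 < T' i \<omega>" for i \<omega>
    unfolding T'_def by (rule storey_eq_Max(3)[OF I lam q])
  have h0: "0 \<le> h i \<omega>" for i \<omega>
    using T'_pos[of i \<omega>] by (auto simp: h_def N_def)
  have [measurable]: "h i \<in> borel_measurable M" if i: "i \<in> I" for i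
  proof -
    have "(\<lambda>\<omega>. ((P \<omega>)(i := 0)) j) \<in> borel_measurable M" if "j \<in> I" for j
      using that by (cases "j = i") auto
    then have [measurable]: "T' i \<in> borel_measurable M"
      unfolding T'_def by (intro borel_measurable_storey I lam q)
    have [measurable]: "N i \<in> borel_measurable M"
      unfolding N_def survivors_def using I
      by (intro measurable_card_Collect) (auto intro!: borel_measurable_less)
    note [measurable] = z[OF i] E[OF i] P_meas[OF i]
    show ?thesis unfolding h_def by measurable
  qed
  \<comment> \<open>Whenever \<open>i\<close> is rejected, \<open>T' i\<close> and \<open>T\<close>
    coincide and \<open>1 / R\<close> is bounded by the term \<open>h i\<close>; the remaining terms
    on the right are nonnegative.\<close>
  have pointwise: "real (card {i \<in> rejected I (P \<omega>) (T \<omega>). z i \<omega> \<in> E i}) / R \<omega>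
      \<le> (\<Sum>i\<in>I. (1 - lam) * q * h i \<omega>)" for \<omega>
  proof -
    have "{i \<in> rejected I (P \<omega>) (T \<omega>). z i \<omega> \<in> E i} = {i \<in> I. z i \<omega> \<in> E i \<and> P \<omega> i \<le> T \<omega>}"
      by (auto simp: rejected_def)
    then have "real (card {i \<in> rejected I (P \<omega>) (T \<omega>). z i \<omega> \<in> E i}) / R \<omega> =
        (\<Sum>i\<in>I. if z i \<omega> \<in> E i \<and> P \<omega> i \<le> T \<omega> then 1 / R \<omega> else 0)"
      using I by (simp add: sum.If_cases Int_def)
    also have "\<dots> \<le> (\<Sum>i\<in>I. (1 - lam) * q * h i \<omega>)"
    proof (rule sum_mono)
      fix i assume i: "i \<in> I"
      show "(if z i \<omega> \<in> E i \<and> P \<omega> i \<le> T \<omega> then 1 / R \<omega> else 0) \<le> (1 - lam) * q * h i \<omega>"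
      proof (cases "z i \<omega> \<in> E i \<and> P \<omega> i \<le> T \<omega>")
        case True
        then have le: "P \<omega> i \<le> storey I lam q (P \<omega>)" by (simp add: T_def)
        have "T' i \<omega> = T \<omega>"
          using storey_fun_upd_zero[OF I lam q le] by (simp add: T'_def T_def)
        then show ?thesis
          using True inverse_rejections_le[where p = "P \<omega>", OF I lam q i le]
          by (simp add: h_def R_def T_def T'_def N_def)
      next
        case False
        have "0 \<le> (1 - lam) * q * h i \<omega>"
          using lam q h0 by (intro mult_nonneg_nonneg) auto
        then show ?thesis by (simp only: False if_False)
      qed
    qed
    finally show ?thesis .
  qed
  have term_le: "(\<integral>\<^sup>+\<omega>. ennreal ((1 - lam) * q * h i \<omega>) \<partial>M) \<le> ennreal q * (ennreal (c i) *
      (\<integral>\<^sup>+s. ennreal (\<Prod>j\<in>I - {i}. 1 - (1 - s) * c j) * indicator {0..1} s \<partial>lborel))"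
    if i: "i \<in> I" for i
  proof -
    have "(\<integral>\<^sup>+\<omega>. ennreal ((1 - lam) * q * h i \<omega>) \<partial>M) =
        ennreal ((1 - lam) * q) * (\<integral>\<^sup>+\<omega>. ennreal (h i \<omega>) \<partial>M)"
      using lam q i by (subst nn_integral_cmult[symmetric]) (auto simp: ennreal_mult')
    also have "\<dots> \<le> ennreal ((1 - lam) * q) *
        (ennreal (e i) * (\<integral>\<^sup>+\<omega>. ennreal (1 / (1 + N i \<omega>)) \<partial>M))"
      unfolding h_def P_def T'_def N_def e_def
      by (intro mult_left_mono rejected_error_term[OF i]) simp
    also have "\<dots> = ennreal q * (ennreal (c i) * (\<integral>\<^sup>+\<omega>. ennreal (1 / (1 + N i \<omega>)) \<partial>M))"
    proof -
      have "ennreal ((1 - lam) * q) * ennreal (e i) = ennreal q * ennreal (c i)"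
        using lam q c01[OF i] by (simp add: c_def ennreal_mult'[symmetric] mult_ac)
      then show ?thesis by (simp add: mult.assoc[symmetric])
    qed
    \<comment> \<open>Survivors with the right sign are dropped: a smaller count enlarges the
      reciprocal, and \<open>late_error_bound\<close> speaks of wrong signs only.\<close>
    also have "\<dots> \<le> ennreal q * (ennreal (c i) * (\<integral>\<^sup>+\<omega>.
        ennreal (1 / (1 + real (card {j \<in> I - {i}. z j \<omega> \<in> {x \<in> E j. lam < pv j x}}))) \<partial>M))"
    proof (intro mult_left_mono nn_integral_mono ennreal_leI)
      fix \<omega>
      have "card {j \<in> I - {i}. z j \<omega> \<in> {x \<in> E j. lam < pv j x}} \<le> card (survivors (I - {i}) lam (P \<omega>))"
        using I by (intro card_mono) (auto simp: survivors_def P_def)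
      then show "1 / (1 + N i \<omega>) \<le>
          1 / (1 + real (card {j \<in> I - {i}. z j \<omega> \<in> {x \<in> E j. lam < pv j x}}))"
        by (intro divide_left_mono) (auto simp: N_def)
    qed auto
    also have "(\<integral>\<^sup>+\<omega>.
        ennreal (1 / (1 + real (card {j \<in> I - {i}. z j \<omega> \<in> {x \<in> E j. lam < pv j x}}))) \<partial>M) =
      (\<integral>\<^sup>+s. ennreal (\<Prod>j\<in>I - {i}. 1 - (1 - s) * b j) * indicator {0..1} s \<partial>lborel)"
      unfolding b_def
    proof (rule nn_integral_inverse_Suc_card_indep)
      show "{x \<in> E j. lam < pv j x} \<in> sets borel" if "j \<in> I - {i}" for j
      proof -
        note [measurable] = E[of j] pv[of j]
        show ?thesis using that by simp
      qed
    qed (use I in \<open>auto intro: indep_vars_subset[OF indep]\<close>)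
    \<comment> \<open>Each factor decreases in the survival probability, so passing from
      \<open>b j\<close> down to \<open>c j\<close> enlarges the product.\<close>
    also have "\<dots> \<le>
      (\<integral>\<^sup>+s. ennreal (\<Prod>j\<in>I - {i}. 1 - (1 - s) * c j) * indicator {0..1} s \<partial>lborel)"
    proof (rule nn_integral_mono)
      fix s :: real
      show "ennreal (\<Prod>j\<in>I - {i}. 1 - (1 - s) * b j) * indicator {0..1} s
        \<le> ennreal (\<Prod>j\<in>I - {i}. 1 - (1 - s) * c j) * indicator {0..1} s"
      proof (cases "s \<in> {0..1}")
        case True
        have "(\<Prod>j\<in>I - {i}. 1 - (1 - s) * b j) \<le> (\<Prod>j\<in>I - {i}. 1 - (1 - s) * c j)"
        proof (rule prod_mono)
          fix j assume "j \<in> I - {i}"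
          then have j: "j \<in> I" by simp
          have "(1 - s) * b j \<le> 1"
            using True prob01[OF j] by (intro mult_le_one) (auto simp: b_def)
          moreover have "(1 - s) * c j \<le> (1 - s) * b j"
            using True c01[OF j] by (intro mult_left_mono) auto
          ultimately show "0 \<le> 1 - (1 - s) * b j \<and> 1 - (1 - s) * b j \<le> 1 - (1 - s) * c j"
            by simp
        qed
        with True show ?thesis by (simp add: ennreal_leI)
      qed simp
    qed
    finally show ?thesis by (simp add: mult_left_mono)
  qed
  have prod1: "(\<Prod>i\<in>I. 1 - c i) \<le> 1" and prod0: "0 \<le> (\<Prod>i\<in>I. 1 - c i)"
    using c01 by (auto intro!: prod_le_1 prod_nonneg)
  \<comment> \<open>At \<open>s = lam\<close> the generating function of the number of wrong signs
    has factors \<open>1 - c i\<close>: the very product that the telescoping leaves.\<close>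
  have nn: "(\<integral>\<^sup>+\<omega>. ennreal (lam ^ card {i \<in> I. z i \<omega> \<in> E i}) \<partial>M) = ennreal (\<Prod>i\<in>I. 1 - c i)"
    using nn_integral_power_card_indep[OF I indep E, where s = lam] lam by (simp add: c_def e_def)
  have power: "(\<integral>\<omega>. lam ^ card {i \<in> I. z i \<omega> \<in> E i} \<partial>M) = (\<Prod>i\<in>I. 1 - c i)"
  proof -
    have eq: "lam ^ card {i \<in> I. z i \<omega> \<in> E i} = (\<Prod>i\<in>I. if z i \<omega> \<in> E i then lam else 1)" for \<omega>
      using I by (simp add: prod.If_cases Int_def)
    note [measurable] = z E
    have meas: "(\<lambda>\<omega>. \<Prod>i\<in>I. if z i \<omega> \<in> E i then lam else 1) \<in> borel_measurable M"
      by measurable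
    show ?thesis
      using nn prod0 lam meas[folded eq]
      by (subst integral_eq_nn_integral) auto
  qed
  have "(\<integral>\<^sup>+\<omega>. ennreal (real (card {i \<in> rejected I (P \<omega>) (T \<omega>). z i \<omega> \<in> E i}) / R \<omega>) \<partial>M)
      \<le> (\<integral>\<^sup>+\<omega>. (\<Sum>i\<in>I. ennreal ((1 - lam) * q * h i \<omega>)) \<partial>M)"
    using pointwise lam q h0 by (intro nn_integral_mono) (simp add: sum_ennreal ennreal_leI)
  also have "\<dots> = (\<Sum>i\<in>I. \<integral>\<^sup>+\<omega>. ennreal ((1 - lam) * q * h i \<omega>) \<partial>M)"
    by (rule nn_integral_sum) measurable
  also have "\<dots> \<le> (\<Sum>i\<in>I. ennreal q * (ennreal (c i) *
      (\<integral>\<^sup>+s. ennreal (\<Prod>j\<in>I - {i}. 1 - (1 - s) * c j) * indicator {0..1} s \<partial>lborel)))"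
    by (rule sum_mono[OF term_le])
  also have "\<dots> = ennreal q * ennreal (1 - (\<Prod>i\<in>I. 1 - c i))"
    unfolding sum_distrib_left[symmetric]
    by (subst nn_integral_sum_leave_one_out_prod) (use c01 in auto)
  also have "\<dots> = ennreal ((1 - (\<Prod>i\<in>I. 1 - c i)) * q)"
    using q prod1 by (simp add: ennreal_mult'' mult.commute)
  finally show ?thesis
    unfolding power R_def[symmetric] using q prod1 by (intro integral_real_bounded) auto
qed

end

end

section \<open>The directional false discovery rate of two-sided tests\<close>

theorem theorem2p1:
  fixes M :: "'a measure"
    and m :: nat
    and \<theta> :: "nat \<Rightarrow> real"
    and z :: "nat \<Rightarrow> 'a \<Rightarrow> real"
    and F f :: "nat \<Rightarrow> real \<Rightarrow> real \<Rightarrow> real"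
    and q lam :: real
  defines "F0 \<equiv> \<lambda>i. F i 0"
    and "Z \<equiv> \<lambda>\<omega> i. z i \<omega>"
  defines "tq \<equiv> \<lambda>\<omega>. threshold m F0 (Z \<omega>) lam q"
  assumes m: "m \<ge> 1"
    and cdf_F: "\<And>i t. i \<in> {1..m} \<Longrightarrow> distribution_function (F i t)"
    and smooth_F: "\<And>i t. i \<in> {1..m} \<Longrightarrow> smooth (F i t)"
    and strict_F: "\<And>i t. i \<in> {1..m} \<Longrightarrow> strict_mono (F i t)"
    and deriv_F: "\<And>i t x. i \<in> {1..m} \<Longrightarrow> (F i t has_real_derivative f i t x) (at x)"
    and pos_f: "\<And>i t x. i \<in> {1..m} \<Longrightarrow> f i t x > 0"
    and sym_F: "\<And>i x. i \<in> {1..m} \<Longrightarrow> F i 0 (- x) = 1 - F i 0 x"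
    and sym_f: "\<And>i x. i \<in> {1..m} \<Longrightarrow> f i 0 (- x) = f i 0 x"
    and mlr: "\<And>i t t' x x'. i \<in> {1..m} \<Longrightarrow> t < t' \<Longrightarrow> x < x' \<Longrightarrow>
                f i t' x / f i t x \<le> f i t' x' / f i t x'"
    and M: "prob_space M"
    and indep: "prob_space.indep_vars M (\<lambda>_. borel) z {1..m}"
    and cdf_z: "\<And>i. i \<in> {1..m} \<Longrightarrow> cdf (distr M borel (z i)) = F i (\<theta> i)"
    and density_z: "\<And>i. i \<in> {1..m} \<Longrightarrow> distributed M lborel (z i) (\<lambda>x. ennreal (f i (\<theta> i) x))"
    and q: "0 < q" "q < 1"
    and lam: "0 < lam" "lam < 1"
  shows "dir_fdr M \<theta> (\<lambda>\<omega>. rej m F0 (Z \<omega>) (tq \<omega>)) (\<lambda>\<omega> i. sgn (z i \<omega>)) \<le> q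
    \<and> (\<integral>\<omega>. real (card (sign_errors m F0 \<theta> (Z \<omega>) (tq \<omega>)))
              / real (max (card (rej m F0 (Z \<omega>) (tq \<omega>))) 1) \<partial>M)
        \<le> (1 - (\<integral>\<omega>. lam ^ card (sign_errors m F0 \<theta> (Z \<omega>) 1) \<partial>M)) * q
    \<and> (1 - (\<integral>\<omega>. lam ^ card (sign_errors m F0 \<theta> (Z \<omega>) 1) \<partial>M)) * q \<le> q"
proof -
  interpret prob_space M by (rule M)
  define pv where "pv i x = 2 * F i 0 (- \<bar>x\<bar>)" for i x
  define E where "E i = {x. sgn (\<theta> i) \<noteq> sgn x}" for i
  have z: "random_variable borel (z i)" if "i \<in> {1..m}" for i
    using indep that by (auto simp: indep_vars_def)
  have pv_meas: "pv i \<in> borel_measurable borel" if "i \<in> {1..m}" for i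
  proof -
    have [measurable]: "F i 0 \<in> borel_measurable borel"
      by (rule borel_measurable_mono[OF strict_mono_mono[OF strict_F[OF that]]])
    show ?thesis unfolding pv_def by measurable
  qed
  have E_meas: "E i \<in> sets borel" for i
    unfolding E_def by measurable
  have pv_le: "pv i x \<le> 1" if i: "i \<in> {1..m}" for i x
  proof -
    have "F i 0 (- \<bar>x\<bar>) \<le> F i 0 0"
      using strict_mono_less_eq[OF strict_F[OF i]] by simp
    then show ?thesis using sym_F[OF i, of 0] by (simp add: pv_def)
  qed
  have ratio: "measure (distr M borel (z i)) {x \<in> E i. pv i x \<le> s} * t \<le>
      s * measure (distr M borel (z i)) {x \<in> E i. pv i x \<le> t}"
    if i: "i \<in> {1..m}" and st: "0 < s" "s \<le> t" "t \<le> 1" for i s t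
  proof -
    have D: "real_distribution (distr M borel (z i))"
      using z[OF i] by (rule real_distribution_distr)
    show ?thesis
      using sign_error_pvalue_ratio[where F = "F i" and f = "f i", OF D cdf_z[OF i] cdf_F[OF i]
          strict_F[OF i] deriv_F[OF i] pos_f[OF i] sym_F[OF i] sym_f[OF i] mlr[OF i] st]
      by (simp add: E_def pv_def)
  qed
  have pval: "pval F0 (Z \<omega>) = (\<lambda>i. pv i (z i \<omega>))" for \<omega>
    by (simp add: pval_def F0_def Z_def pv_def fun_eq_iff)
  have tq: "tq \<omega> = storey {1..m} lam q (\<lambda>i. pv i (z i \<omega>))" for \<omega>
    by (simp add: tq_def threshold_eq_storey[OF m lam q] pval)
  have rej: "rej m F0 (Z \<omega>) t = rejected {1..m} (\<lambda>i. pv i (z i \<omega>)) t" for \<omega> t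
    by (simp add: rej_def rejected_def pval)
  have errors: "sign_errors m F0 \<theta> (Z \<omega>) t =
      {i \<in> rejected {1..m} (\<lambda>i. pv i (z i \<omega>)) t. z i \<omega> \<in> E i}" for \<omega> t
    unfolding sign_errors_def rej by (simp add: E_def Z_def)
  \<comment> \<open>No p-value exceeds 1, so at level 1 everything is rejected and all wrong signs
    are counted.\<close>
  have errors1: "sign_errors m F0 \<theta> (Z \<omega>) 1 = {i \<in> {1..m}. z i \<omega> \<in> E i}" for \<omega>
    unfolding errors using pv_le by (auto simp: rejected_def)
  have main: "(\<integral>\<omega>. real (card (sign_errors m F0 \<theta> (Z \<omega>) (tq \<omega>)))
              / real (max (card (rej m F0 (Z \<omega>) (tq \<omega>))) 1) \<partial>M)
        \<le> (1 - (\<integral>\<omega>. lam ^ card (sign_errors m F0 \<theta> (Z \<omega>) 1) \<partial>M)) * q"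
    unfolding errors1 unfolding errors rej tq
    by (rule storey_error_rate[OF _ indep pv_meas E_meas pv_le ratio lam q(1)]) auto
  have "0 \<le> (\<integral>\<omega>. lam ^ card (sign_errors m F0 \<theta> (Z \<omega>) 1) \<partial>M)"
    using lam by simp
  then have le_q: "(1 - (\<integral>\<omega>. lam ^ card (sign_errors m F0 \<theta> (Z \<omega>) 1) \<partial>M)) * q \<le> q"
    using q by (simp add: algebra_simps)
  have "(\<Sum>i\<in>rej m F0 (Z \<omega>) t. of_bool (sgn (\<theta> i) \<noteq> sgn (z i \<omega>))) =
      real (card (sign_errors m F0 \<theta> (Z \<omega>) t))" for \<omega> t
    by (simp add: sign_errors_def Z_def rej_def Int_def)
  then have "dir_fdr M \<theta> (\<lambda>\<omega>. rej m F0 (Z \<omega>) (tq \<omega>)) (\<lambda>\<omega> i. sgn (z i \<omega>)) =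
      (\<integral>\<omega>. real (card (sign_errors m F0 \<theta> (Z \<omega>) (tq \<omega>)))
              / real (max (card (rej m F0 (Z \<omega>) (tq \<omega>))) 1) \<partial>M)"
    by (simp add: dir_fdr_def max.commute)
  with main le_q show ?thesis by linarith
qed

end
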